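(* Let $\alpha=(\alpha_1,\dots,\alpha_m)$ be a generic length vector. Let $J=J_1\cup J_2$ with $J_1\subseteq[m-1]^+$, $J_2\subseteq[m-1]^-$ and $J_1\cap(-J_2)=\emptyset$. Then $J$ is an admissible subset of $[m-1]^{\pm}$ if and only if $J_1\cup\{m\}$ and $-J_2$ are $\alpha$-short subsets of $[m]$.
   Context: A length vector is a tuple of positive reals; generic means $\sum_i\varepsilon_i\alpha_i\ne0$ for all signs. $I\subseteq[m]$ is $\alpha$-short if $\sum_{i\in I}\alpha_i<\sum_{j\notin I}\alpha_j$. Let $[m-1]^+=\{1,\dots,m-1\}$, $[m-1]^-=\{-1,\dots,-(m-1)\}$, $[m-1]^\pm$ their union, $-J_2=\{-j:j\in J_2\}$, $\alpha_{J_1}=\sum_{i\in J_1}\alpha_i$, $\alpha_{J_2}=\sum_{j\in-J_2}\alpha_j$. $J$ is admissible if $J_1\cap(-J_2)=\emptyset$ and $|\alpha_m+\alpha_{J_1}-\alpha_{J_2}|<\sum_{k\in[m-1]\setminus(J_1\cup-J_2)}\alpha_k$ (i.e. the reduced length vector $(\alpha_{j_1},\dots,\alpha_{j_k},|\alpha_m+\alpha_{J_1}-\alpha_{J_2}|)$ with $\{j_1,\dots,j_k\}=[m-1]\setminus(J_1\cup-J_2)$ defines a nonempty generic chain space). *)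

theory Defs
  imports Complex_Main
begin

text \<open>
  Signed subsets of \<open>[m-1]\<close> are sets of integers, so the index set \<open>[m]\<close> is also taken inside
  the integers and a vector \<open>(\<alpha>\<^sub>1, \<dots>, \<alpha>\<^sub>m)\<close> is a function on the integers of which only the values
  on \<open>{1..m}\<close> matter. The set \<open>-J\<^sub>2\<close> is then literally the image of \<open>J\<^sub>2\<close> under negation.
\<close>

definition index_set :: "nat \<Rightarrow> int set"
  where "index_set m = {1..int m}"

definition pos_index_set :: "nat \<Rightarrow> int set"
  where "pos_index_set m = {1..int m - 1}"

definition neg_index_set :: "nat \<Rightarrow> int set"
  where "neg_index_set m = {-(int m - 1)..-1}"

definition signed_index_set :: "nat \<Rightarrow> int set"
  where "signed_index_set m = pos_index_set m \<union> neg_index_set m"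

definition length_vector :: "nat \<Rightarrow> (int \<Rightarrow> real) \<Rightarrow> bool"
  where "length_vector m \<alpha> \<longleftrightarrow> (\<forall>i\<in>index_set m. \<alpha> i > 0)"

definition generic :: "nat \<Rightarrow> (int \<Rightarrow> real) \<Rightarrow> bool"
  where "generic m \<alpha> \<longleftrightarrow>
    (\<forall>\<epsilon> :: int \<Rightarrow> real. (\<forall>i\<in>index_set m. \<epsilon> i \<in> {1, -1}) \<longrightarrow> (\<Sum>i\<in>index_set m. \<epsilon> i * \<alpha> i) \<noteq> 0)"

definition short :: "nat \<Rightarrow> (int \<Rightarrow> real) \<Rightarrow> int set \<Rightarrow> bool"
  where "short m \<alpha> I \<longleftrightarrow>
    I \<subseteq> index_set m \<and> (\<Sum>i\<in>I. \<alpha> i) < (\<Sum>j\<in>index_set m - I. \<alpha> j)"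

text \<open>
  The decomposition \<open>J = J\<^sub>1 \<union> J\<^sub>2\<close> of a signed subset is determined by \<open>J\<close>, so
  admissibility is a property of \<open>J\<close> alone. The strict inequality is what it means for the reduced
  vector, whose last entry is \<open>\<bar>\<alpha>\<^sub>m + \<alpha>(J\<^sub>1) - \<alpha>(J\<^sub>2)\<bar>\<close>, to define a nonempty generic chain space.
\<close>

definition admissible :: "nat \<Rightarrow> (int \<Rightarrow> real) \<Rightarrow> int set \<Rightarrow> bool"
  where "admissible m \<alpha> J \<longleftrightarrow>
    J \<subseteq> signed_index_set m \<and>
    (let J1 = J \<inter> pos_index_set m;
         J2 = J \<inter> neg_index_set m
     in J1 \<inter> uminus ` J2 = {} \<and>
        \<bar>\<alpha> (int m) + (\<Sum>i\<in>J1. \<alpha> i) - (\<Sum>j\<in>uminus ` J2. \<alpha> j)\<bar>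
          < (\<Sum>k\<in>pos_index_set m - (J1 \<union> uminus ` J2). \<alpha> k))"

end

theory Submission
  imports Defs
begin

text \<open>Admissibility bounds an absolute value \<open>\<bar>x\<bar>\<close> by the sum of
  \<alpha> over \<open>K\<close>, which is the conjunction of a bound on \<open>x\<close> and one on
  \<open>-x\<close>. Moving the sum over \<open>B\<close> to the right in the first gives shortness
  of \<open>J1 \<union> {int m}\<close>; the second, rearranged likewise, is shortness of
  \<open>B\<close>.\<close>

theorem theorem4p11:
  fixes m :: nat and \<alpha> :: "int \<Rightarrow> real" and J J1 J2 :: "int set"
  assumes "m \<ge> 1"
    and "length_vector m \<alpha>"
    and "generic m \<alpha>"
    and "J = J1 \<union> J2"
    and "J1 \<subseteq> pos_index_set m"
    and "J2 \<subseteq> neg_index_set m"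
    and "J1 \<inter> uminus ` J2 = {}"
  shows "admissible m \<alpha> J \<longleftrightarrow>
    short m \<alpha> (J1 \<union> {int m}) \<and> short m \<alpha> (uminus ` J2)"
proof -
  define B where "B = uminus ` J2"
  define K where "K = pos_index_set m - (J1 \<union> B)"
  have Bsub: "B \<subseteq> pos_index_set m"
    using assms(6) by (auto simp: B_def pos_index_set_def neg_index_set_def)
  have fin: "finite J1" "finite B" "finite K"
    using assms(5) Bsub finite_subset[of _ "pos_index_set m"]
    by (auto simp: K_def pos_index_set_def)
  \<comment> \<open>This is where \<open>m \<ge> 1\<close> enters: for \<open>m = 0\<close> the
    index \<open>int m\<close> would lie outside the empty \<open>index_set m\<close>.\<close>
  have index_set: "index_set m = insert (int m) (pos_index_set m)"
    using assms(1) by (auto simp: index_set_def pos_index_set_def)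
  have m_notin: "int m \<notin> pos_index_set m"
    by (simp add: pos_index_set_def)
  have disj: "J1 \<inter> B = {}" "J1 \<inter> K = {}" "B \<inter> K = {}"
    "int m \<notin> J1" "int m \<notin> B" "int m \<notin> K"
    using assms(5,7) Bsub m_notin by (auto simp: B_def K_def)
  have compl: "index_set m - (J1 \<union> {int m}) = B \<union> K"
    "index_set m - B = insert (int m) (J1 \<union> K)"
    using assms(5) Bsub disj m_notin by (auto simp: index_set K_def)
  \<comment> \<open>Admissibility sees only \<open>J\<close>; its signs recover \<open>J1\<close>
    and \<open>J2\<close>, as no index is both positive and negative.\<close>
  have "J \<inter> pos_index_set m = J1" "J \<inter> neg_index_set m = J2" "J \<subseteq> signed_index_set m"
    using assms(4-6) by (auto simp: signed_index_set_def pos_index_set_def neg_index_set_def)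
  then have "admissible m \<alpha> J \<longleftrightarrow> \<bar>\<alpha> (int m) + sum \<alpha> J1 - sum \<alpha> B\<bar> < sum \<alpha> K"
    using assms(7) by (simp add: admissible_def B_def K_def)
  moreover have "short m \<alpha> (J1 \<union> {int m}) \<longleftrightarrow> \<alpha> (int m) + sum \<alpha> J1 < sum \<alpha> B + sum \<alpha> K"
    using assms(5) fin disj unfolding short_def compl
    by (auto simp: index_set sum.union_disjoint)
  moreover have "short m \<alpha> B \<longleftrightarrow> sum \<alpha> B < \<alpha> (int m) + sum \<alpha> J1 + sum \<alpha> K"
    using Bsub fin disj unfolding short_def compl
    by (auto simp: index_set sum.union_disjoint)
  ultimately show ?thesis
    \<comment> \<open>Only real arithmetic in four block sums is left: the case split on the
      absolute value yields the two shortness inequalities.\<close>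
    unfolding B_def[symmetric] by linarith
qed

end
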